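(* Let $\mathbf H,\mathbf V,A,N,\nu,\gamma,c_0$ be as in the context, and let $\mathbf F\in L^\infty(0,\infty;\mathbf H)$. There exists a constant $C_g>0$, independent of the time step $k$ and of the initial data, such that the following holds. For every $k>0$ and all $(\mathbf u^i,q^i)\in \mathbf V\times\mathbb R$, $i=0,1$, there exists an integer $N_0=N_0(k)$ such that the solution $(\mathbf u^n,q^n)_{n\ge 0}$ of the mr-SAV-BDF2 scheme $$\frac{3\mathbf u^{n+1}-4\mathbf u^n+\mathbf u^{n-1}}{2k}+\nu A\mathbf u^{n+1}+q^{n+1}N(2\mathbf u^n-\mathbf u^{n-1})=\mathbf F(t^{n+1}),$$ $$\frac{3q^{n+1}-4q^n+q^{n-1}}{2k}+\gamma q^{n+1}-\langle N(2\mathbf u^n-\mathbf u^{n-1}),\mathbf u^{n+1}\rangle=\gamma,\qquad n\ge 1,$$ with $t^n=nk$, satisfies $$\|V^{n}\|_G^2+|Q^{n}|_G^2\le R_0^2\quad\text{for all } n\ge N_0,\qquad R_0^2:=C_g\Big(\frac{1}{c_0\nu}\|\mathbf F\|_{L^\infty(0,\infty;\mathbf H)}^2+\gamma\Big),$$ where $V^n=[\mathbf u^n,\mathbf u^{n-1}]^T$ and $Q^n=[q^n,q^{n-1}]^T$.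
   Context: $\mathbf H$ is a real Hilbert space with inner product $(\cdot,\cdot)$ and norm $\|\cdot\|$. $A$ is a positive definite self-adjoint linear operator on $\mathbf H$ with compact resolvent, $\mathbf V=\mathcal D(A^{1/2})$, and $c_0>0$ is the first eigenvalue of $A$, so that $\|A^{1/2}\mathbf u\|^2\ge c_0\|\mathbf u\|^2$ for all $\mathbf u\in\mathbf V$. One has $\mathbf V\subset\mathbf H\subset\mathbf V'$ with duality $\langle \mathbf f,\mathbf v\rangle=(A^{-1/2}\mathbf f,A^{1/2}\mathbf v)$. The nonlinear operator $N:\mathbf V\to\mathbf V'$ satisfies $\langle N(\mathbf u),\mathbf u\rangle=0$ for all $\mathbf u\in\mathbf V$. $\nu>0$ and $\gamma>0$ are constants. The force $\mathbf F:(0,\infty)\to\mathbf H$ is uniformly bounded in time, and $\|\mathbf F\|_{L^\infty(0,\infty;\mathbf H)}$ denotes $\sup_{t>0}\|\mathbf F(t)\|$. The first equation of the scheme is understood in $\mathbf V'$, with $\mathbf u^{n+1}\in\mathbf V$ and $q^{n+1}\in\mathbb R$. $G$-norms: with $G=\frac14\begin{bmatrix}5&-2\\-2&1\end{bmatrix}$, for $V=[v_1,v_2]^T\in\mathbf H\times\mathbf H$, $\|V\|_G^2=\frac54\|v_1\|^2-(v_1,v_2)+\frac14\|v_2\|^2$; $|\cdot|_G$ is the analogous norm on $\mathbb R\times\mathbb R$. *)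

theory Defs
  imports "HOL-Analysis.Analysis"
begin

text \<open>
  An unbounded operator on a real Hilbert space is a pair of a domain D and a function A;
  the values of A outside D are irrelevant.
\<close>

definition linear_operator :: "'a::real_inner set \<Rightarrow> ('a \<Rightarrow> 'a) \<Rightarrow> bool" where
  "linear_operator D A \<longleftrightarrow> subspace D \<and>
     (\<forall>u\<in>D. \<forall>v\<in>D. A (u + v) = A u + A v) \<and>
     (\<forall>r. \<forall>u\<in>D. A (r *\<^sub>R u) = r *\<^sub>R A u)"

definition operator_graph :: "'a set \<Rightarrow> ('a \<Rightarrow> 'a) \<Rightarrow> ('a \<times> 'a) set" where
  "operator_graph D A = {(u, A u) | u. u \<in> D}"

definition adjoint_graph :: "'a::real_inner set \<Rightarrow> ('a \<Rightarrow> 'a) \<Rightarrow> ('a \<times> 'a) set" where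
  "adjoint_graph D A = {(v, w). \<forall>u\<in>D. A u \<bullet> v = u \<bullet> w}"

definition self_adjoint_operator :: "'a::real_inner set \<Rightarrow> ('a \<Rightarrow> 'a) \<Rightarrow> bool" where
  "self_adjoint_operator D A \<longleftrightarrow>
     linear_operator D A \<and> closure D = UNIV \<and> adjoint_graph D A = operator_graph D A"

definition positive_definite_operator :: "'a::real_inner set \<Rightarrow> ('a \<Rightarrow> 'a) \<Rightarrow> bool" where
  "positive_definite_operator D A \<longleftrightarrow> (\<forall>u\<in>D. u \<noteq> 0 \<longrightarrow> A u \<bullet> u > 0)"

definition compact_operator :: "('a::real_normed_vector \<Rightarrow> 'a) \<Rightarrow> bool" where
  "compact_operator T \<longleftrightarrow> linear T \<and> (\<forall>S. bounded S \<longrightarrow> compact (closure (T ` S)))"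

definition compact_resolvent :: "'a::real_inner set \<Rightarrow> ('a \<Rightarrow> 'a) \<Rightarrow> bool" where
  "compact_resolvent D A \<longleftrightarrow>
     (\<exists>l::real. bij_betw (\<lambda>u. A u - l *\<^sub>R u) D UNIV \<and>
                compact_operator (inv_into D (\<lambda>u. A u - l *\<^sub>R u)))"

definition operator_eigenvalue :: "'a::real_inner set \<Rightarrow> ('a \<Rightarrow> 'a) \<Rightarrow> real \<Rightarrow> bool" where
  "operator_eigenvalue D A l \<longleftrightarrow> (\<exists>u\<in>D. u \<noteq> 0 \<and> A u = l *\<^sub>R u)"

definition first_eigenvalue :: "'a::real_inner set \<Rightarrow> ('a \<Rightarrow> 'a) \<Rightarrow> real \<Rightarrow> bool" where
  "first_eigenvalue D A c \<longleftrightarrow>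
     operator_eigenvalue D A c \<and> (\<forall>l. operator_eigenvalue D A l \<longrightarrow> c \<le> l)"

text \<open>
  \<open>(V, B)\<close> is the operator \<open>A\<^sup>1\<^sup>/\<^sup>2\<close> with its domain: the nonnegative self-adjoint operator
  whose square, on its natural domain, is \<open>(D, A)\<close>.
\<close>

definition operator_sqrt ::
  "'a::real_inner set \<Rightarrow> ('a \<Rightarrow> 'a) \<Rightarrow> 'a set \<Rightarrow> ('a \<Rightarrow> 'a) \<Rightarrow> bool" where
  "operator_sqrt D A V B \<longleftrightarrow>
     self_adjoint_operator V B \<and> (\<forall>u\<in>V. B u \<bullet> u \<ge> 0) \<and>
     D = {u \<in> V. B u \<in> V} \<and> (\<forall>u\<in>D. A u = B (B u))"

text \<open>
  V is normed by \<open>\<parallel>B v\<parallel>\<close> with \<open>B = A\<^sup>1\<^sup>/\<^sup>2\<close>, and V' consists of the bounded linear functionals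
  on V; two functions represent the same element of V' iff they agree on V. The pairing of
  f in V' with v in V is \<open>f v\<close>. The extension \<open>A\<^sup>-\<^sup>1\<^sup>/\<^sup>2 : V' \<rightarrow> H\<close> sends f to the Riesz
  representative w with \<open>f v = w \<bullet> B v\<close> for all v in V, so that
  \<open>f v = A\<^sup>-\<^sup>1\<^sup>/\<^sup>2 f \<bullet> A\<^sup>1\<^sup>/\<^sup>2 v\<close>.
\<close>

definition dual_space :: "'a::real_inner set \<Rightarrow> ('a \<Rightarrow> 'a) \<Rightarrow> ('a \<Rightarrow> real) set" where
  "dual_space V B = {f.
     (\<forall>u\<in>V. \<forall>v\<in>V. f (u + v) = f u + f v) \<and>
     (\<forall>r. \<forall>v\<in>V. f (r *\<^sub>R v) = r * f v) \<and>
     (\<exists>C. \<forall>v\<in>V. \<bar>f v\<bar> \<le> C * norm (B v))}"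

text \<open>The inclusion of H in V', and the extension of A to a map from V to V'.\<close>

definition dual_embed :: "'a::real_inner \<Rightarrow> 'a \<Rightarrow> real" where
  "dual_embed h = (\<lambda>v. h \<bullet> v)"

definition dual_extend :: "('a::real_inner \<Rightarrow> 'a) \<Rightarrow> 'a \<Rightarrow> 'a \<Rightarrow> real" where
  "dual_extend B u = (\<lambda>v. B u \<bullet> B v)"

definition mr_sav_bdf2 ::
  "'a::real_inner set \<Rightarrow> ('a \<Rightarrow> 'a) \<Rightarrow> ('a \<Rightarrow> 'a \<Rightarrow> real) \<Rightarrow> real \<Rightarrow> real \<Rightarrow> (real \<Rightarrow> 'a) \<Rightarrow>
   real \<Rightarrow> (nat \<Rightarrow> 'a) \<Rightarrow> (nat \<Rightarrow> real) \<Rightarrow> bool" where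
  "mr_sav_bdf2 V B N \<nu> \<gamma> F k u q \<longleftrightarrow>
     (\<forall>n. u n \<in> V) \<and>
     (\<forall>n\<ge>1.
        (\<forall>v\<in>V.
           dual_embed ((1 / (2 * k)) *\<^sub>R (3 *\<^sub>R u (n + 1) - 4 *\<^sub>R u n + u (n - 1))) v
             + \<nu> * dual_extend B (u (n + 1)) v
             + q (n + 1) * N (2 *\<^sub>R u n - u (n - 1)) v
           = dual_embed (F (real (n + 1) * k)) v) \<and>
        (3 * q (n + 1) - 4 * q n + q (n - 1)) / (2 * k) + \<gamma> * q (n + 1)
             - N (2 *\<^sub>R u n - u (n - 1)) (u (n + 1)) = \<gamma>)"

text \<open>
  The squared G-norm on \<open>H \<times> H\<close>; at type \<open>real\<close>, where the inner product is multiplication,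
  it is the squared G-norm on pairs of reals.
\<close>

definition G_norm_sq :: "'a::real_inner \<times> 'a \<Rightarrow> real" where
  "G_norm_sq p = 5/4 * (norm (fst p))\<^sup>2 - fst p \<bullet> snd p + 1/4 * (norm (snd p))\<^sup>2"

end

theory Submission
  imports Defs
begin

text \<open>
  Testing the first equation with \<open>u\<^sup>n\<^sup>+\<^sup>1\<close> and multiplying the second by \<open>q\<^sup>n\<^sup>+\<^sup>1\<close> makes the
  nonlinear terms cancel. In \<open>H \<times> \<real>\<close> the scheme becomes a dissipative BDF2 recursion
  \<open>E\<^sub>n\<^sub>+\<^sub>1 + k \<alpha> |X\<^sub>n\<^sub>+\<^sub>1|\<^sup>2 \<le> E\<^sub>n + k M\<close> for the squared G-norms \<open>E\<^sub>n\<close>. The modified energy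
  \<open>E\<^sub>n + (k \<alpha> / 2) |X\<^sub>n|\<^sup>2\<close> then decays geometrically up to a source. For \<open>k \<alpha> \<le> 1\<close> its first
  summand gives a bound uniform in \<open>k\<close>, for \<open>k \<alpha> \<ge> 1\<close> its second one does. Coercivity of
  \<open>A\<^sup>1\<^sup>/\<^sup>2\<close>, with some positive constant, follows from compactness of the resolvent by
  contradiction.
\<close>

section \<open>Self-adjoint and compact operators; coercivity of the square root\<close>

lemma self_adjoint_operator_sym:
  assumes "self_adjoint_operator V B" "x \<in> V" "y \<in> V"
  shows "B x \<bullet> y = x \<bullet> B y"
proof -
  have "(y, B y) \<in> adjoint_graph V B"
    using assms unfolding self_adjoint_operator_def operator_graph_def by blast
  then show ?thesis
    using assms by (simp add: adjoint_graph_def)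
qed

text \<open>A self-adjoint operator has the graph of its adjoint, and that graph is cut out by
  conditions that survive limits.\<close>

lemma self_adjoint_operator_closed:
  assumes sa: "self_adjoint_operator V B" and V: "\<And>n. X n \<in> V"
    and x: "X \<longlonglongrightarrow> x" and y: "(\<lambda>n. B (X n)) \<longlonglongrightarrow> y"
  shows "x \<in> V \<and> B x = y"
proof -
  have "B u \<bullet> x = u \<bullet> y" if "u \<in> V" for u
  proof (rule LIMSEQ_unique)
    show "(\<lambda>n. B u \<bullet> X n) \<longlonglongrightarrow> B u \<bullet> x"
      by (intro tendsto_intros x)
    show "(\<lambda>n. B u \<bullet> X n) \<longlonglongrightarrow> u \<bullet> y"
      unfolding self_adjoint_operator_sym[OF sa that V] by (intro tendsto_intros y)
  qed
  then have "(x, y) \<in> adjoint_graph V B"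
    by (simp add: adjoint_graph_def)
  then show ?thesis
    using sa unfolding self_adjoint_operator_def operator_graph_def by auto
qed

lemma compact_operator_bounded:
  assumes "compact_operator T"
  shows "\<exists>K. \<forall>x. norm (T x) \<le> K * norm x"
proof -
  have lin: "linear T"
    using assms by (simp add: compact_operator_def)
  have "compact (closure (T ` cball 0 1))"
    using assms by (simp add: compact_operator_def)
  then have "bounded (T ` cball 0 1)"
    by (rule bounded_subset[OF compact_imp_bounded closure_subset])
  then obtain K where K: "\<And>x. norm x \<le> 1 \<Longrightarrow> norm (T x) \<le> K"
    unfolding bounded_iff by (metis imageI mem_cball_0)
  have "norm (T x) \<le> K * norm x" for x
  proof (cases "x = 0")
    case True
    then show ?thesis by (simp add: linear_0[OF lin])
  next
    case False
    have "norm (T ((1 / norm x) *\<^sub>R x)) \<le> K"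
      using False by (intro K) simp
    then show ?thesis
      using False by (simp add: linear_scale[OF lin] field_simps)
  qed
  then show ?thesis by blast
qed

text \<open>Otherwise there are unit vectors \<open>U n\<close> with \<open>B (U n)\<close> tending
  to 0. The resolvent turns this into convergence of a subsequence of \<open>U\<close> itself, and
  the limit is a unit vector in the kernel of \<open>B\<close>, hence of \<open>A\<close>. The
  spectral theorem is avoided, at the price of a constant that is not explicit.\<close>

lemma operator_sqrt_coercive:
  fixes B :: "'a::{real_inner, complete_space} \<Rightarrow> 'a"
  assumes pd: "positive_definite_operator D A" and cr: "compact_resolvent D A"
    and sq: "operator_sqrt D A V B"
  shows "\<exists>c>0. \<forall>u\<in>V. c * (norm u)\<^sup>2 \<le> (norm (B u))\<^sup>2"
proof (rule ccontr)
  assume neg: "\<not> ?thesis"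
  have sa: "self_adjoint_operator V B" and D: "D = {u \<in> V. B u \<in> V}"
    and A: "\<And>u. u \<in> D \<Longrightarrow> A u = B (B u)"
    using sq by (auto simp: operator_sqrt_def)
  have subV: "subspace V" and Badd: "\<And>u v. u \<in> V \<Longrightarrow> v \<in> V \<Longrightarrow> B (u + v) = B u + B v"
    and Bscale: "\<And>r u. u \<in> V \<Longrightarrow> B (r *\<^sub>R u) = r *\<^sub>R B u"
    using sa by (auto simp: self_adjoint_operator_def linear_operator_def)
  have Bdiff: "B (u - r *\<^sub>R v) = B u - r *\<^sub>R B v" if "u \<in> V" "v \<in> V" for u v r
    using Badd[OF that(1) subspace_scale[OF subV that(2), of "- r"]] Bscale[OF that(2), of "- r"]
    by simp
  obtain l where bij: "bij_betw (\<lambda>u. A u - l *\<^sub>R u) D UNIV"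
    and comp: "compact_operator (inv_into D (\<lambda>u. A u - l *\<^sub>R u))"
    using cr by (auto simp: compact_resolvent_def)
  define T where "T = inv_into D (\<lambda>u. A u - l *\<^sub>R u)"
  have TD: "T x \<in> D" for x
    unfolding T_def using bij by (metis UNIV_I bij_betw_imp_surj_on inv_into_into)
  have AT: "A (T x) = x + l *\<^sub>R T x" for x
    using bij_betw_inv_into_right[OF bij, of x] by (simp add: T_def algebra_simps)
  have TA: "T (A x - l *\<^sub>R x) = x" if "x \<in> D" for x
    unfolding T_def using bij_betw_inv_into_left[OF bij that] by simp
  obtain K where K: "\<And>x. norm (T x) \<le> K * norm x"
    using compact_operator_bounded[OF comp] unfolding T_def by blast
  \<comment> \<open>\<open>B T\<close> is bounded because its square is the form of \<open>A\<close>
    at \<open>T x\<close>, where \<open>A T = I + l T\<close> and \<open>T\<close> are both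
    bounded.\<close>
  have BT_bound: "(norm (B (T x)))\<^sup>2 \<le> (1 + \<bar>l\<bar> * K) * K * (norm x)\<^sup>2" for x
  proof -
    have "(norm (B (T x)))\<^sup>2 = A (T x) \<bullet> T x"
      using self_adjoint_operator_sym[OF sa, of "B (T x)" "T x"] TD[of x] A[OF TD[of x]]
      by (simp add: D power2_norm_eq_inner)
    also have "\<dots> \<le> norm (A (T x)) * norm (T x)"
      by (rule norm_cauchy_schwarz)
    also have "\<dots> \<le> ((1 + \<bar>l\<bar> * K) * norm x) * (K * norm x)"
    proof (rule mult_mono)
      have "norm (A (T x)) \<le> norm x + \<bar>l\<bar> * norm (T x)"
        unfolding AT by (metis norm_scaleR norm_triangle_ineq)
      also have "\<dots> \<le> norm x + \<bar>l\<bar> * (K * norm x)"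
        by (intro add_left_mono mult_left_mono K) simp
      finally show "norm (A (T x)) \<le> (1 + \<bar>l\<bar> * K) * norm x"
        by (simp add: algebra_simps)
      then show "0 \<le> (1 + \<bar>l\<bar> * K) * norm x"
        using norm_ge_zero order_trans by blast
    qed (use K in auto)
    finally show ?thesis by (simp add: power2_eq_square mult_ac)
  qed
  \<comment> \<open>\<open>T\<close> and \<open>B\<close> commute on \<open>V\<close>, so smallness of \<open>B u\<close> makes \<open>u + l T u\<close> small.\<close>
  have BTB: "B (T (B u)) = u + l *\<^sub>R T u" if u: "u \<in> V" for u
  proof -
    have Tu: "T u \<in> V" "B (T u) \<in> V" using TD[of u] by (auto simp: D)
    have ATu: "B (B (T u)) = u + l *\<^sub>R T u" using AT A TD by simp
    then have "B (B (T u)) \<in> V"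
      using u Tu subV by (simp add: subspace_add subspace_scale)
    then have BTu: "B (T u) \<in> D" using Tu by (simp add: D)
    \<comment> \<open>\<open>B (T u)\<close> solves the resolvent equation with right-hand side
      \<open>B u\<close>; its only solution is \<open>T (B u)\<close>.\<close>
    have "A (B (T u)) - l *\<^sub>R B (T u) = B (B (B (T u)) - l *\<^sub>R T u)"
      using A[OF BTu] Bdiff \<open>B (B (T u)) \<in> V\<close> Tu by simp
    also have "\<dots> = B u" by (simp add: ATu)
    finally have "T (B u) = B (T u)" using TA[OF BTu] by simp
    then show ?thesis using ATu by simp
  qed
  have "\<exists>u\<in>V. norm u = 1 \<and> (norm (B u))\<^sup>2 \<le> 1 / Suc n" for n
  proof -
    obtain v where v: "v \<in> V" "(norm (B v))\<^sup>2 < 1 / Suc n * (norm v)\<^sup>2"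
      using neg by (metis not_le of_nat_0_less_iff zero_less_Suc zero_less_divide_1_iff)
    then have "v \<noteq> 0" by (metis mult_zero_right norm_zero not_less zero_le_power2 zero_power2)
    then have "(norm (B ((1 / norm v) *\<^sub>R v)))\<^sup>2 \<le> 1 / Suc n"
      using v by (simp add: Bscale power_divide divide_simps)
    then show ?thesis
      using v subV \<open>v \<noteq> 0\<close> by (intro bexI[of _ "(1 / norm v) *\<^sub>R v"]) (auto simp: subspace_scale)
  qed
  then obtain U where U: "\<And>n. U n \<in> V" "\<And>n. norm (U n) = 1"
    "\<And>n. (norm (B (U n)))\<^sup>2 \<le> 1 / Suc n"
    by metis
  have BU2: "(\<lambda>n. (norm (B (U n)))\<^sup>2) \<longlonglongrightarrow> 0"
    by (rule tendsto_sandwich[OF _ _ tendsto_const LIMSEQ_Suc[OF lim_1_over_n]])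
      (use U in auto)
  then have BU: "(\<lambda>n. B (U n)) \<longlonglongrightarrow> 0"
    using tendsto_real_sqrt[OF BU2] by (simp add: tendsto_norm_zero_iff)
  have "(\<lambda>n. (norm (B (T (B (U n)))))\<^sup>2) \<longlonglongrightarrow> 0"
    by (rule tendsto_sandwich[OF _ _ tendsto_const tendsto_mult_right_zero[OF BU2]])
      (use BT_bound in \<open>auto intro!: always_eventually\<close>)
  then have "(\<lambda>n. B (T (B (U n)))) \<longlonglongrightarrow> 0"
    using tendsto_real_sqrt[of "\<lambda>n. (norm (B (T (B (U n)))))\<^sup>2" 0] by (simp add: tendsto_norm_zero_iff)
  then have UT: "(\<lambda>n. U n + l *\<^sub>R T (U n)) \<longlonglongrightarrow> 0"
    using BTB U(1) by simp
  have "compact (closure (T ` cball 0 1))"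
    using comp by (auto simp: compact_operator_def T_def)
  moreover have "\<forall>n. T (U n) \<in> closure (T ` cball 0 1)"
    using U(2) by (intro allI subsetD[OF closure_subset] imageI) simp
  ultimately obtain y r where r: "strict_mono (r::nat \<Rightarrow> nat)"
    and y: "((\<lambda>n. T (U n)) \<circ> r) \<longlonglongrightarrow> y"
    unfolding compact_def by (elim allE[of _ "\<lambda>n. T (U n)"] impE) blast+
  \<comment> \<open>Along \<open>r\<close> the part \<open>l T U\<close> converges by compactness,
    so \<open>U\<close> does too.\<close>
  have "(\<lambda>n. (U (r n) + l *\<^sub>R T (U (r n))) - l *\<^sub>R T (U (r n))) \<longlonglongrightarrow> 0 - l *\<^sub>R y"
    using LIMSEQ_subseq_LIMSEQ[OF UT r] y
    by (intro tendsto_intros) (auto simp: o_def)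
  then have lim: "(\<lambda>n. U (r n)) \<longlonglongrightarrow> - l *\<^sub>R y" by simp
  define u where "u = - l *\<^sub>R y"
  have "(\<lambda>n. B (U (r n))) \<longlonglongrightarrow> 0"
    using LIMSEQ_subseq_LIMSEQ[OF BU r] by (simp add: o_def)
  then have u: "u \<in> V" "B u = 0"
    using self_adjoint_operator_closed[OF sa, of "\<lambda>n. U (r n)"] U(1) lim by (auto simp: u_def)
  have "norm u = 1"
    using tendsto_norm[OF lim] U(2) by (simp add: u_def LIMSEQ_const_iff)
  moreover have "u \<in> D" using u subspace_0[OF subV] by (simp add: D)
  moreover have "B 0 = 0" using Bscale[OF subspace_0[OF subV], of 0] by simp
  then have "A u \<bullet> u = 0" using A[OF \<open>u \<in> D\<close>] u by simp
  ultimately show False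
    using pd unfolding positive_definite_operator_def by (metis less_irrefl norm_zero zero_neq_one)
qed

section \<open>Algebra of the G-norm\<close>

text \<open>The G-stability identity of BDF2: tested with the newest value, the difference quotient
  is an energy increment plus the square of a second difference, which is dissipative.\<close>

lemma G_norm_sq_bdf2:
  "(3 *\<^sub>R a - 4 *\<^sub>R b + c) \<bullet> a / 2 =
     G_norm_sq (a, b) - G_norm_sq (b, c) + (norm (a - 2 *\<^sub>R b + c))\<^sup>2 / 4"
  by (simp add: G_norm_sq_def power2_norm_eq_inner algebra_simps inner_commute field_simps)

lemma G_norm_sq_nonneg: "0 \<le> G_norm_sq (a, b)"
proof -
  have "G_norm_sq (a, b) = (norm (2 *\<^sub>R a - b))\<^sup>2 / 4 + (norm a)\<^sup>2 / 4"
    by (simp add: G_norm_sq_def power2_norm_eq_inner algebra_simps inner_commute field_simps)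
  then show ?thesis by simp
qed

text \<open>The factor 3/2 rounds up the largest eigenvalue of \<open>G\<close>, (3 + 2 sqrt 2) / 4.
  This lets dissipation at two time levels control the energy.\<close>

lemma G_norm_sq_le: "G_norm_sq (a, b) \<le> 3/2 * ((norm a)\<^sup>2 + (norm b)\<^sup>2)"
proof -
  have "3/2 * ((norm a)\<^sup>2 + (norm b)\<^sup>2) - G_norm_sq (a, b) =
      (norm (a + 2 *\<^sub>R b))\<^sup>2 / 4 + (norm b)\<^sup>2 / 4"
    by (simp add: G_norm_sq_def power2_norm_eq_inner algebra_simps inner_commute field_simps)
  then show ?thesis
    by (metis add_nonneg_nonneg diff_ge_0_iff_ge divide_nonneg_nonneg zero_le_numeral zero_le_power2)
qed

text \<open>Lets velocity and scalar variable be treated as one sequence in the product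
  space.\<close>

lemma G_norm_sq_Pair:
  "G_norm_sq ((a, p), (b, q)) = G_norm_sq (a, b) + G_norm_sq (p, q)"
  by (simp add: G_norm_sq_def norm_Pair algebra_simps)

section \<open>Absorbing balls for dissipative BDF2 recursions\<close>

text \<open>The value \<open>s / b\<close> is the fixed point of the recursion with equality, and
  the distance above it shrinks by the factor \<open>1 / (1 + b)\<close>.\<close>

lemma contracting_recursion_bound:
  fixes e :: "nat \<Rightarrow> real"
  assumes "b > 0" and "s \<ge> 0" and "\<And>n. (1 + b) * e (Suc n) \<le> e n + s"
  shows "e n \<le> (1 / (1 + b)) ^ n * e 0 + s / b"
proof -
  define r where "r = 1 / (1 + b)"
  have r: "0 < r" "r * (1 + b) = 1" using assms(1) by (auto simp: r_def)
  have step: "e (Suc n) - s / b \<le> r * (e n - s / b)" for n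
  proof -
    have "r * ((1 + b) * e (Suc n)) \<le> r * (e n + s)"
      using assms(3) r by (intro mult_left_mono) auto
    then have "e (Suc n) \<le> r * (e n + s)"
      using r(2) by (simp flip: mult.assoc)
    moreover have "s / b = r * (s / b + s)"
    proof -
      have "s / b + s = s / b * (1 + b)"
        using assms(1) by (simp add: field_simps)
      then show ?thesis
        using r(2) by (metis mult.left_commute mult.right_neutral)
    qed
    ultimately show ?thesis
      unfolding right_diff_distrib distrib_left by linarith
  qed
  have "e n - s / b \<le> r ^ n * (e 0 - s / b)"
  proof (induction n)
    case (Suc n)
    then show ?case
      using step[of n] mult_left_mono[OF Suc, of r] r(1)
      by (simp only: power_Suc mult.assoc) linarith
  qed simp
  also have "\<dots> \<le> r ^ n * e 0"
    using assms(1,2) r(1) by (simp add: mult_left_mono)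
  finally show ?thesis by (simp add: r_def)
qed

text \<open>The index is chosen before the sequence: the transient depends only on the two initial
  values. The radius does not involve \<open>k\<close>.\<close>

lemma bdf2_absorbing:
  fixes x0 x1 :: "'b::real_inner"
  assumes k: "k > 0" and \<alpha>: "\<alpha> > 0" and M: "M > 0"
  shows "\<exists>N\<^sub>0\<ge>1. \<forall>X::nat \<Rightarrow> 'b. X 0 = x0 \<and> X 1 = x1 \<and>
     (\<forall>n. (3 *\<^sub>R X (n + 2) - 4 *\<^sub>R X (n + 1) + X n) \<bullet> X (n + 2) / 2
            + k * \<alpha> * (norm (X (n + 2)))\<^sup>2 \<le> k * M) \<longrightarrow>
     (\<forall>n\<ge>N\<^sub>0. G_norm_sq (X n, X (n - 1)) \<le> 48 * M / \<alpha>)"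
proof -
  define a where "a = k * \<alpha>"
  \<comment> \<open>Chosen so that \<open>b\<close> times the factor \<open>(3 + a) / 2\<close>
    bounding the modified energy is \<open>a / 2\<close>, half of the dissipation rate.\<close>
  define b where "b = a / (3 + a)"
  define L where "L = k * M / b"
  define e0 where "e0 = G_norm_sq (x1, x0) + a / 2 * (norm x1)\<^sup>2"
  have a: "a > 0" using k \<alpha> by (simp add: a_def)
  have b: "b > 0" using a by (simp add: b_def)
  have L: "L > 0" using k M b by (simp add: L_def)
  have L_eq: "L * \<alpha> = M * (3 + a)"
    using k \<alpha> a by (simp add: L_def b_def a_def field_simps)
  have "(\<lambda>n. (1 / (1 + b)) ^ n * e0) \<longlonglongrightarrow> 0"
    using b by (intro tendsto_mult_left_zero LIMSEQ_realpow_zero) auto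
  then have "\<forall>\<^sub>F n in sequentially. (1 / (1 + b)) ^ n * e0 < L"
    using L by (rule order_tendstoD)
  then obtain m where m: "\<And>n. n \<ge> m \<Longrightarrow> (1 / (1 + b)) ^ n * e0 < L"
    unfolding eventually_sequentially by blast
  have "G_norm_sq (X n, X (n - 1)) \<le> 48 * M / \<alpha>"
    if X0: "X 0 = x0" "X 1 = x1" and n: "n \<ge> m + 2"
      and rec: "\<And>n. (3 *\<^sub>R X (n + 2) - 4 *\<^sub>R X (n + 1) + X n) \<bullet> X (n + 2) / 2
                   + k * \<alpha> * (norm (X (n + 2)))\<^sup>2 \<le> k * M" for X n
  proof -
    \<comment> \<open>Indices are shifted by one, so that \<open>e 0\<close> is determined by
      \<open>x0\<close> and \<open>x1\<close>.\<close>
    define E where "E n = G_norm_sq (X (Suc n), X n)" for n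
    define y where "y n = (norm (X (Suc n)))\<^sup>2" for n
    define e where "e n = E n + a / 2 * y n" for n
    have y: "y n \<ge> 0" for n by (simp add: y_def)
    have E_nonneg: "E n \<ge> 0" for n by (simp add: E_def G_norm_sq_nonneg)
    have E_le: "E (Suc n) \<le> 3/2 * (y (Suc n) + y n)" for n
      unfolding E_def y_def by (rule G_norm_sq_le)
    have energy: "E (Suc n) - E n + a * y (Suc n) \<le> k * M" for n
    proof -
      have "0 \<le> (norm (X (n + 2) - 2 *\<^sub>R X (n + 1) + X n))\<^sup>2 / 4" by simp
      then show ?thesis
        using rec[of n] unfolding G_norm_sq_bdf2 E_def y_def a_def
        by (simp only: add_2_eq_Suc' Suc_eq_plus1[symmetric])
    qed
    have step: "(1 + b) * e (Suc n) \<le> e n + k * M" for n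
    proof -
      have "e (Suc n) \<le> (3 + a) / 2 * (y (Suc n) + y n)"
        using E_le[of n] a y[of n]
        by (simp add: e_def algebra_simps add_divide_distrib add_increasing)
      then have "b * e (Suc n) \<le> b * ((3 + a) / 2 * (y (Suc n) + y n))"
        using b by (intro mult_left_mono) auto
      also have "\<dots> = a / 2 * (y (Suc n) + y n)"
        using a by (simp add: b_def field_simps)
      finally have "b * e (Suc n) \<le> a / 2 * (y (Suc n) + y n)" .
      \<comment> \<open>Half of the dissipation \<open>a * y (Suc n)\<close> enters
        \<open>e (Suc n)\<close>. The other half, with the term \<open>a / 2 * y n\<close> of
        \<open>e n\<close>, pays for \<open>b * e (Suc n)\<close>.\<close>
      moreover have "e (Suc n) + a / 2 * (y (Suc n) + y n) \<le> e n + k * M"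
        using energy[of n] by (simp add: e_def distrib_left)
      ultimately show ?thesis
        by (simp only: distrib_right mult_1)
    qed
    have e: "e n \<le> 2 * L" if "n \<ge> m" for n
    proof -
      have e_0: "e 0 = e0" using X0 by (simp add: e_def e0_def E_def y_def)
      have "0 \<le> k * M" using k M by simp
      from contracting_recursion_bound[of b "k * M" e n, OF b this step] m[OF that]
      show ?thesis unfolding e_0 L_def[symmetric] by linarith
    qed
    obtain j where j: "n = Suc (Suc j)" "j \<ge> m"
      using n by (auto simp: le_iff_add)
    have "E (Suc j) \<le> 48 * M / \<alpha>"
    proof (cases "a \<le> 1")
      case True
      have "E (Suc j) \<le> 2 * L"
        using e[of "Suc j"] j mult_nonneg_nonneg[of "a / 2" "y (Suc j)"] a y[of "Suc j"]
        unfolding e_def by linarith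
      then have "E (Suc j) * \<alpha> \<le> 2 * (M * (3 + a))"
        using mult_right_mono[OF _ less_imp_le[OF \<alpha>], of "E (Suc j)" "2 * L"] L_eq by linarith
      \<comment> \<open>Here \<open>3 + a\<close> is at most 4; the generous 24 only matches the
        constant of the other case.\<close>
      also have "\<dots> \<le> 2 * (M * 24)"
        using True M by (intro mult_left_mono) auto
      finally show ?thesis using \<alpha> by (simp add: field_simps)
    next
      case False
      \<comment> \<open>The level \<open>2 * L\<close> grows with \<open>k\<close>, but so does the
        weight \<open>a / 2\<close> of \<open>y\<close>. Since \<open>3 + a\<close> is at most
        \<open>4 * a\<close>, the factor \<open>a\<close> cancels.\<close>
      have "y i * \<alpha> \<le> 16 * M" if "i \<ge> m" for i
      proof -
        have "a / 2 * y i \<le> 2 * L" using e[OF that] E_nonneg[of i] by (simp add: e_def)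
        then have "a * (y i * \<alpha>) \<le> 4 * (L * \<alpha>)"
          using mult_right_mono[OF _ less_imp_le[OF \<alpha>], of "a / 2 * y i" "2 * L"]
          by (simp add: mult.assoc)
        also have "\<dots> \<le> 4 * (M * (4 * a))"
          unfolding L_eq using False M by (intro mult_left_mono) auto
        finally have "a * (y i * \<alpha>) \<le> a * (16 * M)" by (simp add: mult_ac)
        then show ?thesis using a by simp
      qed
      from this[of j] this[of "Suc j"] j have "(y (Suc j) + y j) * \<alpha> \<le> 32 * M"
        by (simp add: distrib_right)
      then have "E (Suc j) * \<alpha> \<le> 48 * M"
        using mult_right_mono[OF E_le[of j] less_imp_le[OF \<alpha>]] by linarith
      then show ?thesis using \<alpha> by (simp add: field_simps)
    qed
    then show ?thesis by (simp add: E_def j)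
  qed
  then show ?thesis by (intro exI[of _ "m + 2"]) auto
qed

section \<open>Energy inequality of the scheme\<close>

lemma young_inner:
  fixes f x :: "'b::real_inner"
  assumes "d > 0"
  shows "f \<bullet> x \<le> (norm f)\<^sup>2 / (2 * d) + d / 2 * (norm x)\<^sup>2"
proof -
  have "(norm f)\<^sup>2 / (2 * d) + d / 2 * (norm x)\<^sup>2 - f \<bullet> x = (norm (f - d *\<^sub>R x))\<^sup>2 / (2 * d)"
    using assms by (simp add: power2_norm_eq_inner algebra_simps inner_commute field_simps)
  moreover have "\<dots> \<ge> 0" using assms by simp
  ultimately show ?thesis by linarith
qed

text \<open>Half of the viscous and of the scalar damping absorbs the forcing terms. The rest
  remains as dissipation, with the smaller of the two rates in the product space.\<close>

lemma mr_sav_bdf2_energy: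
  assumes scheme: "mr_sav_bdf2 V B N \<nu> \<gamma> F k u q" and k: "k > 0" and c: "c > 0"
    and coercive: "\<And>v. v \<in> V \<Longrightarrow> c * (norm v)\<^sup>2 \<le> (norm (B v))\<^sup>2"
    and \<nu>: "\<nu> > 0" and \<gamma>: "\<gamma> > 0" and F: "\<And>t. t > 0 \<Longrightarrow> norm (F t) \<le> S"
  defines "X \<equiv> \<lambda>n. (u n, q n)"
  shows "(3 *\<^sub>R X (n + 2) - 4 *\<^sub>R X (n + 1) + X n) \<bullet> X (n + 2) / 2
           + k * (min (c * \<nu>) \<gamma> / 2) * (norm (X (n + 2)))\<^sup>2
         \<le> k * (S\<^sup>2 / (2 * (c * \<nu>)) + \<gamma> / 2)"
proof -
  define v r where "v = u (n + 2)" and "r = q (n + 2)"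
  define w where "w = 2 *\<^sub>R u (n + 1) - u n"
  define du where "du = 3 *\<^sub>R v - 4 *\<^sub>R u (n + 1) + u n"
  define dq where "dq = 3 * r - 4 * q (n + 1) + q n"
  define f where "f = F (real (n + 2) * k)"
  have v: "v \<in> V" using scheme by (simp add: mr_sav_bdf2_def v_def)
  \<comment> \<open>The scheme at index \<open>n + 1\<close>, its first equation tested with
    \<open>v\<close>.\<close>
  have eqs: "(1 / (2 * k)) *\<^sub>R du \<bullet> v + \<nu> * (B v \<bullet> B v) + r * N w v = f \<bullet> v"
    "dq / (2 * k) + \<gamma> * r - N w v = \<gamma>"
    using scheme[unfolded mr_sav_bdf2_def, THEN conjunct2, THEN spec[of _ "n + 1"]] v
    by (simp_all add: dual_embed_def dual_extend_def v_def r_def w_def du_def dq_def f_def)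
  have eq1: "du \<bullet> v / 2 = k * (f \<bullet> v) - k * \<nu> * (norm (B v))\<^sup>2 - k * (r * N w v)"
    using arg_cong[OF eqs(1), of "\<lambda>x. k * x"] k
    by (simp add: algebra_simps power2_norm_eq_inner)
  have eq2: "dq * r / 2 = k * (\<gamma> * r) - k * \<gamma> * r\<^sup>2 + k * (r * N w v)"
    using arg_cong[OF eqs(2), of "\<lambda>x. k * r * x"] k
    by (simp add: algebra_simps power2_eq_square)
  have "(norm f)\<^sup>2 \<le> S\<^sup>2"
    using F[of "real (n + 2) * k"] k by (intro power_mono) (auto simp: f_def)
  \<comment> \<open>The Young weight \<open>c * \<nu>\<close> uses exactly half of the
    coercivity.\<close>
  then have "f \<bullet> v \<le> S\<^sup>2 / (2 * (c * \<nu>)) + c * \<nu> / 2 * (norm v)\<^sup>2"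
    using young_inner[of "c * \<nu>" f v] c \<nu>
      divide_right_mono[of "(norm f)\<^sup>2" "S\<^sup>2" "2 * (c * \<nu>)"] by simp
  moreover have "\<nu> * (c * (norm v)\<^sup>2) \<le> \<nu> * (norm (B v))\<^sup>2"
    using coercive[OF v] \<nu> by (intro mult_left_mono) auto
  moreover have "\<gamma> * r \<le> \<gamma> / 2 + \<gamma> / 2 * r\<^sup>2"
    using mult_left_mono[of "2 * r" "1 + r\<^sup>2" "\<gamma> / 2"] \<gamma> sum_squares_bound[of 1 r]
    by (simp add: algebra_simps)
  moreover have "min (c * \<nu>) \<gamma> / 2 * (norm v)\<^sup>2 \<le> c * \<nu> / 2 * (norm v)\<^sup>2"
    "min (c * \<nu>) \<gamma> / 2 * r\<^sup>2 \<le> \<gamma> / 2 * r\<^sup>2"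
    by (intro mult_right_mono; simp)+
  ultimately have "f \<bullet> v - \<nu> * (norm (B v))\<^sup>2 + (\<gamma> * r - \<gamma> * r\<^sup>2)
      + min (c * \<nu>) \<gamma> / 2 * ((norm v)\<^sup>2 + r\<^sup>2) \<le> S\<^sup>2 / (2 * (c * \<nu>)) + \<gamma> / 2"
    by (simp add: algebra_simps)
  from mult_left_mono[OF this, of k] k
  have "du \<bullet> v / 2 + dq * r / 2 + k * (min (c * \<nu>) \<gamma> / 2) * ((norm v)\<^sup>2 + r\<^sup>2)
      \<le> k * (S\<^sup>2 / (2 * (c * \<nu>)) + \<gamma> / 2)"
    unfolding eq1 eq2 by (simp add: algebra_simps)
  moreover have "(3 *\<^sub>R X (n + 2) - 4 *\<^sub>R X (n + 1) + X n) \<bullet> X (n + 2) = du \<bullet> v + dq * r"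
    by (simp add: X_def v_def r_def du_def dq_def)
  moreover have "(norm (X (n + 2)))\<^sup>2 = (norm v)\<^sup>2 + r\<^sup>2"
    by (simp add: X_def norm_Pair v_def r_def)
  ultimately show ?thesis
    by (simp only: add_divide_distrib)
qed

section \<open>The absorbing ball of the scheme\<close>

theorem theorem3p2:
  fixes D V :: "'a::{real_inner, complete_space} set"
    and A sqrtA :: "'a \<Rightarrow> 'a"
    and N :: "'a \<Rightarrow> 'a \<Rightarrow> real"
    and F :: "real \<Rightarrow> 'a"
    and \<nu> \<gamma> c\<^sub>0 :: real
  assumes "self_adjoint_operator D A"
    and "positive_definite_operator D A"
    and "compact_resolvent D A"
    and "operator_sqrt D A V sqrtA"
    and "first_eigenvalue D A c\<^sub>0" and "c\<^sub>0 > 0"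
    and "\<forall>u\<in>V. N u \<in> dual_space V sqrtA"
    and "\<forall>u\<in>V. N u u = 0"
    and "\<nu> > 0" and "\<gamma> > 0"
    and "bounded (F ` {0<..})"
  shows "\<exists>C\<^sub>g>0. \<forall>k>0. \<forall>u\<^sub>0\<in>V. \<forall>u\<^sub>1\<in>V. \<forall>q\<^sub>0 q\<^sub>1. \<exists>N\<^sub>0\<ge>1. \<forall>u q.
           u 0 = u\<^sub>0 \<and> u 1 = u\<^sub>1 \<and> q 0 = q\<^sub>0 \<and> q 1 = q\<^sub>1 \<and>
           mr_sav_bdf2 V sqrtA N \<nu> \<gamma> F k u q \<longrightarrow>
           (\<forall>n\<ge>N\<^sub>0. G_norm_sq (u n, u (n - 1)) + G_norm_sq (q n, q (n - 1))
              \<le> C\<^sub>g * (1 / (c\<^sub>0 * \<nu>) * (SUP t\<in>{0<..}. norm (F t))\<^sup>2 + \<gamma>))"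
proof -
  obtain c where c: "c > 0" "\<And>v. v \<in> V \<Longrightarrow> c * (norm v)\<^sup>2 \<le> (norm (sqrtA v))\<^sup>2"
    using operator_sqrt_coercive[OF assms(2-4)] by blast
  define S where "S = (SUP t\<in>{0<..}. norm (F t))"
  define \<alpha> where "\<alpha> = min (c * \<nu>) \<gamma> / 2"
  define M where "M = S\<^sup>2 / (2 * (c * \<nu>)) + \<gamma> / 2"
  \<comment> \<open>The first factor comes from the absorbing radius; the bracket trades
    \<open>c\<close> for \<open>c\<^sub>0\<close> in \<open>M\<close>. Neither \<open>k\<close> nor
    the initial data enter.\<close>
  define C\<^sub>g where "C\<^sub>g = 48 / \<alpha> * (c\<^sub>0 / (2 * c) + 1 / 2)"
  have "bdd_above ((\<lambda>t. norm (F t)) ` {0<..})"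
    using assms(11) by (auto simp: bounded_iff bdd_above_def)
  then have F: "norm (F t) \<le> S" if "t > 0" for t
    unfolding S_def using that by (intro cSUP_upper) auto
  have \<alpha>: "\<alpha> > 0" using c assms(9,10) by (simp add: \<alpha>_def)
  have M: "M > 0" using c assms(9,10) by (simp add: M_def add_nonneg_pos)
  have C\<^sub>g: "C\<^sub>g > 0" using \<alpha> c assms(6) by (simp add: C\<^sub>g_def add_pos_pos)
  have "M \<le> (c\<^sub>0 / (2 * c) + 1 / 2) * (1 / (c\<^sub>0 * \<nu>) * S\<^sup>2 + \<gamma>)"
  proof -
    \<comment> \<open>Two of the four products add up to \<open>M\<close>; the cross terms are
      nonnegative.\<close>
    have "(c\<^sub>0 / (2 * c) + 1 / 2) * (1 / (c\<^sub>0 * \<nu>) * S\<^sup>2 + \<gamma>)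
        = M + c\<^sub>0 / (2 * c) * \<gamma> + 1 / 2 * (1 / (c\<^sub>0 * \<nu>) * S\<^sup>2)"
      using c assms(6,9) by (simp add: M_def field_simps)
    then show ?thesis using c assms(6,9,10) by simp
  qed
  from mult_left_mono[OF this, of "48 / \<alpha>"]
  have R: "48 * M / \<alpha> \<le> C\<^sub>g * (1 / (c\<^sub>0 * \<nu>) * S\<^sup>2 + \<gamma>)"
    unfolding C\<^sub>g_def using \<alpha> by (simp only: mult.assoc times_divide_eq_left) simp
  have "\<exists>N\<^sub>0\<ge>1. \<forall>u q. u 0 = u\<^sub>0 \<and> u 1 = u\<^sub>1 \<and> q 0 = q\<^sub>0 \<and> q 1 = q\<^sub>1 \<and>
      mr_sav_bdf2 V sqrtA N \<nu> \<gamma> F k u q \<longrightarrow>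
      (\<forall>n\<ge>N\<^sub>0. G_norm_sq (u n, u (n - 1)) + G_norm_sq (q n, q (n - 1))
         \<le> C\<^sub>g * (1 / (c\<^sub>0 * \<nu>) * S\<^sup>2 + \<gamma>))"
    if k: "k > 0" for k u\<^sub>0 u\<^sub>1 q\<^sub>0 q\<^sub>1
  proof -
    obtain N\<^sub>0 :: nat where N\<^sub>0: "N\<^sub>0 \<ge> 1" and
      absorb: "\<forall>X. X 0 = (u\<^sub>0, q\<^sub>0) \<and> X 1 = (u\<^sub>1, q\<^sub>1) \<and>
        (\<forall>n. (3 *\<^sub>R X (n + 2) - 4 *\<^sub>R X (n + 1) + X n) \<bullet> X (n + 2) / 2
            + k * \<alpha> * (norm (X (n + 2)))\<^sup>2 \<le> k * M) \<longrightarrow>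
        (\<forall>n\<ge>N\<^sub>0. G_norm_sq (X n, X (n - 1)) \<le> 48 * M / \<alpha>)"
      using bdf2_absorbing[OF k \<alpha> M, of "(u\<^sub>0, q\<^sub>0)" "(u\<^sub>1, q\<^sub>1)"] by (elim exE conjE) rule
    have "G_norm_sq (u n, u (n - 1)) + G_norm_sq (q n, q (n - 1)) \<le> 48 * M / \<alpha>"
      if init: "u 0 = u\<^sub>0" "u 1 = u\<^sub>1" "q 0 = q\<^sub>0" "q 1 = q\<^sub>1"
        and scheme: "mr_sav_bdf2 V sqrtA N \<nu> \<gamma> F k u q" and n: "n \<ge> N\<^sub>0" for u q n
    proof -
      note energy = mr_sav_bdf2_energy[OF scheme k c assms(9,10) F, folded \<alpha>_def M_def]
      have "(u 0, q 0) = (u\<^sub>0, q\<^sub>0)" "(u 1, q 1) = (u\<^sub>1, q\<^sub>1)" using init by simp_all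
      from absorb[THEN spec[of _ "\<lambda>n. (u n, q n)"], rule_format,
          OF conjI[OF this(1) conjI[OF this(2) allI[OF energy]]] n]
      show ?thesis by (simp only: G_norm_sq_Pair)
    qed
    then show ?thesis
      using N\<^sub>0 by (intro exI[of _ N\<^sub>0] conjI allI impI order_trans[OF _ R]) auto
  qed
  then show ?thesis using C\<^sub>g unfolding S_def by blast
qed

end
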